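(* Let $G$ be a simple graph on $n$ vertices and let $k$ be an integer with $2\le k\le n-2$. If the maximum degree $\Delta(G)\ge 5$ or the circumference $c(G)\ge 5$, then $F_k(G)$ is non-planar.
   Context: For a simple graph $G=(V,E)$ on $n$ vertices and an integer $1\le k<n$, the $k$-token graph $F_k(G)$ is the graph whose vertices are all $k$-element subsets of $V$, two such subsets $A,B$ being adjacent whenever their symmetric difference $A\triangle B$ is a pair $\{a,b\}$ with $a$ adjacent to $b$ in $G$. The circumference $c(G)$ is the maximum length of a cycle in $G$ (with $c(G)=0$ if $G$ has no cycle). *)

theory Defs
  imports "HOL-Analysis.Analysis"
begin

definition simple_graph :: "'v set \<Rightarrow> 'v set set \<Rightarrow> bool" where
  "simple_graph V E \<longleftrightarrow> finite V \<and>
     (\<forall>e\<in>E. \<exists>u v. e = {u, v} \<and> u \<noteq> v \<and> u \<in> V \<and> v \<in> V)"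

definition token_vertices :: "'v set \<Rightarrow> nat \<Rightarrow> 'v set set" where
  "token_vertices V k = {A. A \<subseteq> V \<and> card A = k}"

definition token_edges :: "'v set \<Rightarrow> 'v set set \<Rightarrow> nat \<Rightarrow> 'v set set set" where
  "token_edges V E k = {{A, B} | A B. A \<in> token_vertices V k \<and> B \<in> token_vertices V k \<and>
      (\<exists>a b. A - B \<union> (B - A) = {a, b} \<and> {a, b} \<in> E)}"

definition degree :: "'v set set \<Rightarrow> 'v \<Rightarrow> nat" where
  "degree E v = card {u. {v, u} \<in> E}"

definition max_degree :: "'v set \<Rightarrow> 'v set set \<Rightarrow> nat" where
  "max_degree V E = Max (insert 0 (degree E ` V))"

definition is_cycle :: "'v set \<Rightarrow> 'v set set \<Rightarrow> 'v list \<Rightarrow> bool" where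
  "is_cycle V E vs \<longleftrightarrow> length vs \<ge> 3 \<and> distinct vs \<and> set vs \<subseteq> V \<and>
     (\<forall>i < length vs - 1. {vs ! i, vs ! Suc i} \<in> E) \<and> {last vs, hd vs} \<in> E"

definition circumference :: "'v set \<Rightarrow> 'v set set \<Rightarrow> nat" where
  "circumference V E = Max (insert 0 {length vs | vs. is_cycle V E vs})"

definition planar :: "'v set \<Rightarrow> 'v set set \<Rightarrow> bool" where
  "planar V E \<longleftrightarrow> (\<exists>(pos :: 'v \<Rightarrow> complex) (\<gamma> :: 'v set \<Rightarrow> real \<Rightarrow> complex).
     inj_on pos V \<and>
     (\<forall>e\<in>E. arc (\<gamma> e) \<and> {pathstart (\<gamma> e), pathfinish (\<gamma> e)} = pos ` e) \<and>
     (\<forall>e\<in>E. \<forall>v\<in>V. pos v \<in> path_image (\<gamma> e) \<longrightarrow> v \<in> e) \<and>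
     (\<forall>e\<in>E. \<forall>e'\<in>E. e \<noteq> e' \<longrightarrow> path_image (\<gamma> e) \<inter> path_image (\<gamma> e') \<subseteq> pos ` (e \<inter> e')))"

end

theory Submission
  imports Defs
begin

text \<open>In a plane drawing, the interiors of two chords of a cycle whose ends alternate on the cycle
  cannot lie on the same side of it. Hence a graph is non-planar as soon as the crossing relation
  on the chords of some cycle has an odd closed walk; for the Hamiltonian cycle of \<open>K\<^sub>5\<close> the
  crossing relation is itself a 5-cycle.

  Freezing the tokens that lie outside a subgraph, and exchanging tokens with holes, reduces the
  claim to token graphs of the star with five leaves and of cycles. Two tokens on either the star or
  the 5-cycle give a subdivided \<open>K\<^sub>5\<close>, and subdividing an edge of a graph subdivides edges of
  its token graph, which settles the longer cycles. Only three tokens on the star, the Desargues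
  graph, have to be treated separately.\<close>

section \<open>Arcs and connected sets in the plane\<close>

text \<open>The half-open arc is the continuous image of \<open>{0<..1}\<close>, and injectivity
  keeps the start point out of that image. Chords with one end removed enter
  \<open>theta_crossing\<close> in this form.\<close>

lemma connected_arc_minus_start:
  fixes g :: "real \<Rightarrow> complex"
  assumes "arc g"
  shows "connected (path_image g - {pathstart g})"
proof -
  have "path_image g - {pathstart g} = g ` {0<..1}"
  proof
    show "path_image g - {pathstart g} \<subseteq> g ` {0<..1}"
      using less_eq_real_def by (auto simp: path_image_def pathstart_def)
    have "g t \<noteq> g 0" if "t \<in> {0<..1}" for t
      using assms that inj_onD[of g "{0..1}" t 0] by (auto simp: arc_def)
    then show "g ` {0<..1} \<subseteq> path_image g - {pathstart g}"
      by (auto simp: path_image_def pathstart_def)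
  qed
  moreover have "continuous_on {0<..1} g"
    using assms by (auto simp: arc_def path_def intro: continuous_on_subset)
  ultimately show ?thesis
    by (simp add: connected_continuous_image)
qed

lemma connected_arc_minus_finish:
  fixes g :: "real \<Rightarrow> complex"
  assumes "arc g"
  shows "connected (path_image g - {pathfinish g})"
  using connected_arc_minus_start[OF arc_reversepath[OF assms]] by simp

lemma connected_insert_closure:
  fixes W :: "'a::topological_space set"
  assumes "connected W" "x \<in> closure W"
  shows "connected (insert x W)"
  by (rule connected_intermediate_closure[OF assms(1)]) (use assms closure_subset in auto)

text \<open>Janiszewski's theorem is applied to \<open>A1 \<union> P\<close> and \<open>A2 \<union> P\<close>, which meet in the connected
  set \<open>P\<close>: the set \<open>W\<close> reaches the interior of \<open>Q\<close> through \<open>y\<close> in the complement of the first, and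
  through \<open>x\<close> in the complement of the second.\<close>

lemma theta_crossing:
  fixes A1 A2 P Q W :: "complex set"
  assumes "compact A1" "compact A2" "compact P" "connected P" "A1 \<inter> A2 \<subseteq> P"
    and W: "connected W" "W \<inter> (A1 \<union> A2 \<union> P) = {}" "x \<in> closure W" "y \<in> closure W"
    and Q: "connected (Q - {x})" "connected (Q - {y})" "x \<in> Q" "y \<in> Q" "x \<noteq> y"
      "Q \<inter> A1 \<subseteq> {x}" "Q \<inter> A2 \<subseteq> {y}" "Q \<inter> P = {}"
    and "w \<in> W" "q \<in> Q - {x, y}"
  shows "connected_component (- (A1 \<union> A2)) w q"
proof -
  have "connected (insert y W \<union> (Q - {x}))"
    using W Q by (intro connected_Un connected_insert_closure) auto
  moreover have "insert y W \<union> (Q - {x}) \<subseteq> - (A1 \<union> P)"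
    using W Q by auto
  ultimately have 1: "connected_component (- (A1 \<union> P)) w q"
    unfolding connected_component_def using \<open>w \<in> W\<close> \<open>q \<in> Q - {x, y}\<close> by blast
  have "connected (insert x W \<union> (Q - {y}))"
    using W Q by (intro connected_Un connected_insert_closure) auto
  moreover have "insert x W \<union> (Q - {y}) \<subseteq> - (A2 \<union> P)"
    using W Q by auto
  ultimately have 2: "connected_component (- (A2 \<union> P)) w q"
    unfolding connected_component_def using \<open>w \<in> W\<close> \<open>q \<in> Q - {x, y}\<close> by blast
  have "(A1 \<union> P) \<inter> (A2 \<union> P) = P"
    using assms by auto
  then have "connected_component (- ((A1 \<union> P) \<union> (A2 \<union> P))) w q"
    using Janiszewski[OF _ _ _ 1 2] assms by (simp add: compact_Un compact_imp_closed)
  then show ?thesis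
    by (rule connected_component_of_subset) auto
qed

section \<open>Plane drawings, paths and cycles\<close>

text \<open>The witnesses of \<open>planar\<close> are fixed here so that arcs can be assembled
  inside one given drawing.\<close>

locale drawing =
  fixes V :: "'v set" and E :: "'v set set" and pos :: "'v \<Rightarrow> complex"
    and \<gamma> :: "'v set \<Rightarrow> real \<Rightarrow> complex"
  assumes inj_pos: "inj_on pos V"
    and arc_edge: "e \<in> E \<Longrightarrow> arc (\<gamma> e)"
    and ends_edge: "e \<in> E \<Longrightarrow> {pathstart (\<gamma> e), pathfinish (\<gamma> e)} = pos ` e"
    and vertex_on_edge: "e \<in> E \<Longrightarrow> v \<in> V \<Longrightarrow> pos v \<in> path_image (\<gamma> e) \<Longrightarrow> v \<in> e"
    and edges_meet: "e \<in> E \<Longrightarrow> e' \<in> E \<Longrightarrow> e \<noteq> e' \<Longrightarrow>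
      path_image (\<gamma> e) \<inter> path_image (\<gamma> e') \<subseteq> pos ` (e \<inter> e')"

lemma planar_iff_drawing: "planar V E \<longleftrightarrow> (\<exists>pos \<gamma>. drawing V E pos \<gamma>)"
  unfolding planar_def drawing_def by (intro ex_cong1 iffI) (auto; blast)+

fun path_edges :: "'v list \<Rightarrow> 'v set set" where
  "path_edges (x # y # zs) = insert {x, y} (path_edges (y # zs))"
| "path_edges _ = {}"

definition cycle_edges :: "'v list \<Rightarrow> 'v set set" where
  "cycle_edges vs = path_edges (vs @ [hd vs])"

lemma path_edges_append:
  "path_edges (xs @ y # ys) = path_edges (xs @ [y]) \<union> path_edges (y # ys)"
  by (induction xs rule: path_edges.induct) auto

lemma path_edges_subset_set: "e \<in> path_edges xs \<Longrightarrow> e \<subseteq> set xs"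
  by (induction xs rule: path_edges.induct) auto

text \<open>Consecutive entries cannot both be outer ends when something stands between those. This
  tells the edges of one arc of a cycle from the chord joining its ends and from the edges of the
  opposite arc.\<close>

lemma path_edges_meets_interior:
  assumes "e \<in> path_edges (a # q @ [c])" "q \<noteq> []"
  shows "e \<inter> set q \<noteq> {}"
  using assms
proof (induction q arbitrary: a)
  case (Cons x q)
  then show ?case by (cases q) auto
qed simp

text \<open>Two vertices cut a cycle into two paths. The second path contains the closing edge,
  which returns to \<open>a\<close> itself when \<open>p\<close> is empty; hence the case
  distinction.\<close>

lemma cycle_edges_split:
  "cycle_edges (p @ a # q @ c # r) = path_edges (a # q @ [c]) \<union> path_edges (c # r @ p @ [a])"
proof (cases p)
  case Nil
  then show ?thesis
    using path_edges_append[of "a # q" c "r @ [a]"] by (simp add: cycle_edges_def)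
next
  case (Cons x p')
  then show ?thesis
    using path_edges_append[of p a "q @ c # r @ [x]"] path_edges_append[of "a # q" c "r @ [x]"]
      path_edges_append[of "c # r" x "p' @ [a]"]
    by (auto simp: cycle_edges_def)
qed

context drawing
begin

abbreviation picture :: "'v set set \<Rightarrow> complex set" where
  "picture F \<equiv> \<Union>e\<in>F. path_image (\<gamma> e)"

lemma endpoint_in_image:
  assumes "e \<in> E" "v \<in> e"
  shows "pos v \<in> path_image (\<gamma> e)"
proof -
  have "pos v \<in> {pathstart (\<gamma> e), pathfinish (\<gamma> e)}"
    unfolding ends_edge[OF assms(1)] using assms(2) by (rule imageI)
  then show ?thesis by auto
qed

text \<open>\<open>ends_edge\<close> fixes only the unordered pair of ends, so the arc may have to
  be reversed; its image stays the same.\<close>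

lemma edge_arc_from:
  assumes "{u, v} \<in> E" "u \<noteq> v" "u \<in> V" "v \<in> V"
  obtains g where "arc g" "pathstart g = pos u" "pathfinish g = pos v"
    "path_image g = path_image (\<gamma> {u, v})"
proof -
  have "pos u \<noteq> pos v"
    using assms inj_pos by (auto dest: inj_onD)
  then have "pathstart (\<gamma> {u, v}) = pos u \<and> pathfinish (\<gamma> {u, v}) = pos v \<or>
      pathstart (\<gamma> {u, v}) = pos v \<and> pathfinish (\<gamma> {u, v}) = pos u"
    using ends_edge[OF assms(1)] by (auto simp: doubleton_eq_iff)
  then show ?thesis
    using that[of "\<gamma> {u, v}"] that[of "reversepath (\<gamma> {u, v})"] arc_edge[OF assms(1)]
    by (auto simp: arc_reversepath)
qed

text \<open>Distinctness keeps \<open>x\<close> out of all later edges, so the first edge meets the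
  rest of the path only in \<open>pos y\<close>, and the arcs can be joined one after the
  other.\<close>

lemma path_arc:
  assumes "distinct xs" "2 \<le> length xs" "set xs \<subseteq> V" "path_edges xs \<subseteq> E"
  obtains g where "arc g" "pathstart g = pos (hd xs)" "pathfinish g = pos (last xs)"
    "path_image g = picture (path_edges xs)"
  using assms
proof (induction xs arbitrary: thesis rule: path_edges.induct)
  case (1 x y zs)
  obtain h where h: "arc h" "pathstart h = pos x" "pathfinish h = pos y"
    "path_image h = path_image (\<gamma> {x, y})"
    using 1 edge_arc_from[of x y] by auto
  show ?case
  proof (cases zs)
    case Nil
    with h 1 show ?thesis by auto
  next
    case (Cons z zs')
    obtain g where g: "arc g" "pathstart g = pos y" "pathfinish g = pos (last (y # zs))"
      "path_image g = picture (path_edges (y # zs))"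
      using 1 Cons by auto
    have "path_image (\<gamma> {x, y}) \<inter> path_image (\<gamma> e) \<subseteq> {pos y}" if "e \<in> path_edges (y # zs)" for e
    proof -
      have "x \<notin> e"
        using path_edges_subset_set[OF that] 1 by auto
      then show ?thesis
        using edges_meet[of "{x, y}" e] that 1 by fastforce
    qed
    then have "path_image h \<inter> path_image g \<subseteq> {pos y}"
      using h g by auto
    then have "arc (h +++ g)"
      using h g by (intro arc_join) auto
    moreover have "path_image (h +++ g) = picture (path_edges (x # y # zs))"
      using h g by (simp add: path_image_join)
    ultimately show ?thesis
      using h g 1 by (auto intro!: 1(2)[of "h +++ g"])
  qed
qed auto

lemma vertex_in_picture:
  assumes "v \<in> set xs" "2 \<le> length xs" "path_edges xs \<subseteq> E"
  shows "pos v \<in> picture (path_edges xs)"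
  using assms
proof (induction xs rule: path_edges.induct)
  case (1 x y zs)
  then show ?case
    using endpoint_in_image[of "{x, y}"] by (cases zs) auto
qed auto

lemma picture_meet:
  assumes "F \<subseteq> E" "F' \<subseteq> E" "F \<inter> F' = {}"
  shows "picture F \<inter> picture F' \<subseteq> pos ` (\<Union>F \<inter> \<Union>F')"
proof
  fix z
  assume "z \<in> picture F \<inter> picture F'"
  then obtain e e' where e: "e \<in> F" "e' \<in> F'" "z \<in> path_image (\<gamma> e) \<inter> path_image (\<gamma> e')"
    by blast
  with assms have "z \<in> pos ` (e \<inter> e')"
    using edges_meet[of e e'] by blast
  then show "z \<in> pos ` (\<Union>F \<inter> \<Union>F')"
    using e by blast
qed

section \<open>Crossing chords of a cycle\<close>

text \<open>If both chords lay on the same side of the Jordan curve, then the other side would be a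
  connected set that avoids them and has the whole curve in its closure. By
  \<open>theta_crossing\<close> it could be joined to the interior of the second chord without
  meeting the curve, which separates the two.\<close>

lemma crossing_chords:
  fixes p q r a b c d
  defines "vs \<equiv> p @ a # q @ c # r"
  assumes dist: "distinct vs" and sub: "set vs \<subseteq> V" and cyc: "cycle_edges vs \<subseteq> E"
    and b: "b \<in> set q" and d: "d \<in> set (r @ p)" and ac: "{a, c} \<in> E" and bd: "{b, d} \<in> E"
  shows "path_image (\<gamma> {a, c}) \<inter> inside (picture (cycle_edges vs)) = {} \<longleftrightarrow>
    path_image (\<gamma> {b, d}) \<inter> inside (picture (cycle_edges vs)) \<noteq> {}"
proof -
  define P Q where "P = path_image (\<gamma> {a, c})" and "Q = path_image (\<gamma> {b, d})"
  define A1 A2 where "A1 = picture (path_edges (a # q @ [c]))"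
    and "A2 = picture (path_edges (c # (r @ p) @ [a]))"
  have split: "cycle_edges vs = path_edges (a # q @ [c]) \<union> path_edges (c # (r @ p) @ [a])"
    unfolding vs_def using cycle_edges_split[of p a q c r] by simp
  have E1: "path_edges (a # q @ [c]) \<subseteq> E" and E2: "path_edges (c # (r @ p) @ [a]) \<subseteq> E"
    using cyc split by auto
  have dist': "distinct (a # q @ [c])" "distinct (c # (r @ p) @ [a])"
    "set q \<inter> set (r @ p) = {}"
    using dist by (auto simp: vs_def)
  have V': "set (a # q @ [c]) \<subseteq> V" "set (c # (r @ p) @ [a]) \<subseteq> V"
    using sub by (auto simp: vs_def)
  have U1: "\<Union>(path_edges (a # q @ [c])) \<subseteq> set (a # q @ [c])"
    and U2: "\<Union>(path_edges (c # (r @ p) @ [a])) \<subseteq> set (c # (r @ p) @ [a])"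
    using path_edges_subset_set by blast+
  have ne: "q \<noteq> []" "r @ p \<noteq> []"
    using b d by auto
  have m1: "e \<inter> set q \<noteq> {}" if "e \<in> path_edges (a # q @ [c])" for e
    using path_edges_meets_interior[OF that ne(1)] .
  have m2: "e \<inter> set (r @ p) \<noteq> {}" if "e \<in> path_edges (c # (r @ p) @ [a])" for e
    using path_edges_meets_interior[OF that ne(2)] .
  obtain g1 where g1: "arc g1" "pathstart g1 = pos a" "pathfinish g1 = pos c" "path_image g1 = A1"
    using path_arc[OF dist'(1) _ V'(1) E1] by (auto simp: A1_def)
  obtain g2 where g2: "arc g2" "pathstart g2 = pos c" "pathfinish g2 = pos a" "path_image g2 = A2"
    using path_arc[OF dist'(2) _ V'(2) E2] by (auto simp: A2_def)
  have "e \<notin> path_edges (c # (r @ p) @ [a])" if "e \<in> path_edges (a # q @ [c])" for e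
  proof
    assume "e \<in> path_edges (c # (r @ p) @ [a])"
    then have "e \<subseteq> set (c # (r @ p) @ [a])"
      by (rule path_edges_subset_set)
    moreover have "set q \<inter> set (c # (r @ p) @ [a]) = {}"
      using dist by (auto simp: vs_def)
    ultimately show False
      using m1[OF that] by blast
  qed
  then have "A1 \<inter> A2 \<subseteq> pos ` (\<Union>(path_edges (a # q @ [c])) \<inter> \<Union>(path_edges (c # (r @ p) @ [a])))"
    unfolding A1_def A2_def by (intro picture_meet E1 E2) blast
  also have "\<dots> \<subseteq> pos ` (set (a # q @ [c]) \<inter> set (c # (r @ p) @ [a]))"
    using U1 U2 by (intro image_mono Int_mono)
  also have "set (a # q @ [c]) \<inter> set (c # (r @ p) @ [a]) = {a, c}"
    using dist by (auto simp: vs_def)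
  finally have A12: "A1 \<inter> A2 \<subseteq> {pos a, pos c}"
    by simp
  have inV: "a \<in> V" "b \<in> V" "c \<in> V" "d \<in> V"
    using sub b d by (auto simp: vs_def)
  have neq: "a \<noteq> b" "a \<noteq> c" "a \<noteq> d" "b \<noteq> c" "b \<noteq> d" "c \<noteq> d"
    using dist b d by (auto simp: vs_def)
  have meet1: "path_image (\<gamma> e) \<inter> A1 \<subseteq> pos ` (e \<inter> set (a # q @ [c]))"
    if "e \<in> E" "e \<notin> path_edges (a # q @ [c])" for e
  proof -
    have "picture {e} \<inter> A1 \<subseteq> pos ` (\<Union>{e} \<inter> \<Union>(path_edges (a # q @ [c])))"
      unfolding A1_def using that by (intro picture_meet E1) auto
    also have "\<dots> \<subseteq> pos ` (e \<inter> set (a # q @ [c]))"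
      using U1 by (intro image_mono Int_mono) auto
    finally show ?thesis by simp
  qed
  have meet2: "path_image (\<gamma> e) \<inter> A2 \<subseteq> pos ` (e \<inter> set (c # (r @ p) @ [a]))"
    if "e \<in> E" "e \<notin> path_edges (c # (r @ p) @ [a])" for e
  proof -
    have "picture {e} \<inter> A2 \<subseteq> pos ` (\<Union>{e} \<inter> \<Union>(path_edges (c # (r @ p) @ [a])))"
      unfolding A2_def using that by (intro picture_meet E2) auto
    also have "\<dots> \<subseteq> pos ` (e \<inter> set (c # (r @ p) @ [a]))"
      using U2 by (intro image_mono Int_mono) auto
    finally show ?thesis by simp
  qed
  \<comment> \<open>Both arcs have interior vertices, and each of their edges contains one, so the
    chord \<open>{a, c}\<close> is an edge of neither.\<close>
  have "{a, c} \<inter> set q = {}" "{a, c} \<inter> set (r @ p) = {}"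
    using dist by (auto simp: vs_def)
  then have "{a, c} \<notin> path_edges (a # q @ [c])" "{a, c} \<notin> path_edges (c # (r @ p) @ [a])"
    using m1 m2 by blast+
  then have "P \<inter> A1 \<subseteq> pos ` {a, c}" "P \<inter> A2 \<subseteq> pos ` {a, c}"
    unfolding P_def using meet1[OF ac] meet2[OF ac] by blast+
  then have PA: "P \<inter> (A1 \<union> A2) \<subseteq> {pos a, pos c}"
    by auto
  \<comment> \<open>Each end of the second chord lies off one of the arcs. So this chord is an edge
    of neither and touches \<open>A1\<close> at most in \<open>pos b\<close> and \<open>A2\<close>
    at most in \<open>pos d\<close>.\<close>
  have dnot: "d \<notin> set (a # q @ [c])" and bnot: "b \<notin> set (c # (r @ p) @ [a])"
    using b d dist by (auto simp: vs_def)
  then have "{b, d} \<notin> path_edges (a # q @ [c])" "{b, d} \<notin> path_edges (c # (r @ p) @ [a])"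
    using path_edges_subset_set by blast+
  then have "Q \<inter> A1 \<subseteq> pos ` ({b, d} \<inter> set (a # q @ [c]))"
    "Q \<inter> A2 \<subseteq> pos ` ({b, d} \<inter> set (c # (r @ p) @ [a]))"
    unfolding Q_def using meet1[OF bd] meet2[OF bd] by blast+
  moreover have "{b, d} \<inter> set (a # q @ [c]) \<subseteq> {b}" "{b, d} \<inter> set (c # (r @ p) @ [a]) \<subseteq> {d}"
    using dnot bnot by auto
  ultimately have QA: "Q \<inter> A1 \<subseteq> {pos b}" "Q \<inter> A2 \<subseteq> {pos d}"
    by blast+
  have "{b, d} \<noteq> {a, c}"
    using neq by (auto simp: doubleton_eq_iff)
  then have QP: "Q \<inter> P = {}"
    using edges_meet[OF bd ac] neq unfolding P_def Q_def by auto
  obtain gp where gp: "arc gp" "pathstart gp = pos a" "pathfinish gp = pos c" "path_image gp = P"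
    using edge_arc_from[OF ac] neq inV unfolding P_def by metis
  obtain gq where gq: "arc gq" "pathstart gq = pos b" "pathfinish gq = pos d" "path_image gq = Q"
    using edge_arc_from[OF bd] neq inV unfolding Q_def by metis
  have posneq: "pos b \<noteq> pos d"
    using inj_pos inV neq by (auto dest: inj_onD)
  define C where "C = g1 +++ g2"
  have imC: "path_image C = A1 \<union> A2"
    using g1 g2 by (simp add: C_def path_image_join)
  have picC: "picture (cycle_edges vs) = path_image C"
    unfolding imC A1_def A2_def split by auto
  have "simple_path C" "pathfinish C = pathstart C"
    unfolding C_def using g1 g2 A12 by (auto intro!: simple_path_join_loop)
  note J = Jordan_inside_outside[OF this]
  define In Out where "In = inside (path_image C)" and "Out = outside (path_image C)"
  have In: "In \<noteq> {}" "open In" "connected In" "frontier In = path_image C"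
    and Out: "Out \<noteq> {}" "open Out" "connected Out" "frontier Out = path_image C"
    and InOut: "In \<inter> Out = {}" "In \<union> Out = - path_image C"
    using J unfolding In_def Out_def by auto
  have bA1: "pos b \<in> A1" and dA2: "pos d \<in> A2"
    using vertex_in_picture[of b "a # q @ [c]"] vertex_in_picture[of d "c # (r @ p) @ [a]"] b d E1 E2
    unfolding A1_def A2_def by simp_all
  have conn: "connected (P - {pos a, pos c})" "connected (Q - {pos b, pos d})"
    using connected_simple_path_endless[OF arc_imp_simple_path] gp gq by metis+
  obtain q0 where q0: "q0 \<in> Q - {pos b, pos d}"
    using nonempty_simple_path_endless[OF arc_imp_simple_path[OF gq(1)]] gq by auto
  \<comment> \<open>\<open>U\<close> is the side assumed to contain both open chords and
    \<open>W\<close> the opposite one. Leaving open which of them is the inside covers both cases at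
    once.\<close>
  have impossible: False
    if WU: "W \<inter> U = {}" "W \<union> U = - path_image C" "W \<noteq> {}" "connected W" "frontier W = path_image C"
      and ops: "open W" "open U"
      and PU: "P - {pos a, pos c} \<subseteq> U" and QU: "Q - {pos b, pos d} \<subseteq> U" for U W
  proof -
    obtain w where "w \<in> W"
      using WU(3) by blast
    \<comment> \<open>Each side of a Jordan curve has the entire curve as its frontier, so both ends
      of the second chord can be approached from \<open>W\<close>.\<close>
    have fr: "path_image C \<subseteq> closure W"
      using WU(5) by (auto simp: frontier_def)
    have "P \<subseteq> path_image C \<union> U"
    proof -
      have "{pos a, pos c} \<subseteq> A1"
        using g1 pathstart_in_path_image[of g1] pathfinish_in_path_image[of g1] by auto
      then show ?thesis
        using PU imC by auto
    qed
    then have WAP: "W \<inter> (A1 \<union> A2 \<union> P) = {}"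
      using WU PU QU \<open>P \<subseteq> path_image C \<union> U\<close> imC by blast
    have "connected_component (- (A1 \<union> A2)) w q0"
    proof (rule theta_crossing[where P = P and Q = Q and W = W and x = "pos b" and y = "pos d"])
      show "compact A1" "compact A2" "compact P" "connected P"
        using compact_arc_image connected_arc_image g1 g2 gp by metis+
      have "{pos a, pos c} \<subseteq> P"
        using gp pathstart_in_path_image[of gp] pathfinish_in_path_image[of gp] by auto
      then show "A1 \<inter> A2 \<subseteq> P"
        using A12 by auto
      show "connected (Q - {pos b})" "connected (Q - {pos d})"
        using connected_arc_minus_start[OF gq(1)] connected_arc_minus_finish[OF gq(1)] gq by auto
      show "pos b \<in> Q" "pos d \<in> Q"
        using gq pathstart_in_path_image[of gq] pathfinish_in_path_image[of gq] by auto
    qed (use WU WAP fr bA1 dA2 imC QA QP posneq q0 \<open>w \<in> W\<close> in auto)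
    then obtain T where T: "connected T" "T \<subseteq> - path_image C" "w \<in> T" "q0 \<in> T"
      unfolding connected_component_def imC by auto
    have "q0 \<in> U"
      using q0 QU by auto
    then show False
      using connectedD[OF T(1) ops] T WU \<open>w \<in> W\<close> by blast
  qed
  have side: "X \<subseteq> In \<or> X \<subseteq> Out" if "connected X" "X \<inter> path_image C = {}" for X
    using connectedD[OF that(1) In(2) Out(2)] InOut that(2) by blast
  have off: "(P - {pos a, pos c}) \<inter> path_image C = {}" "(Q - {pos b, pos d}) \<inter> path_image C = {}"
    using PA QA imC by blast+
  \<comment> \<open>The ends of the chords lie on the curve, so whether a chord meets the inside
    depends only on its interior, which is connected and lies wholly on one side.\<close>
  have "pos a \<in> A1" "pos c \<in> A1"
    using g1 pathstart_in_path_image[of g1] pathfinish_in_path_image[of g1] by auto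
  then have ends: "{pos a, pos b, pos c, pos d} \<inter> In = {}"
    using imC bA1 dA2 InOut by blast
  have "P - {pos a, pos c} \<noteq> {}"
    using nonempty_simple_path_endless[OF arc_imp_simple_path[OF gp(1)]] gp by auto
  then have P_in: "P \<inter> In = {} \<longleftrightarrow> \<not> P - {pos a, pos c} \<subseteq> In"
    using side[OF conn(1) off(1)] InOut ends by blast
  have Q_in: "Q \<inter> In = {} \<longleftrightarrow> \<not> Q - {pos b, pos d} \<subseteq> In"
    using side[OF conn(2) off(2)] InOut ends q0 by blast
  have "\<not> (P - {pos a, pos c} \<subseteq> In \<and> Q - {pos b, pos d} \<subseteq> In)"
    using impossible[of Out In] In Out InOut by (metis Int_commute Un_commute)
  moreover have "\<not> (P - {pos a, pos c} \<subseteq> Out \<and> Q - {pos b, pos d} \<subseteq> Out)"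
    using impossible[of In Out] In Out InOut by metis
  ultimately show ?thesis
    unfolding picC P_def[symmetric] Q_def[symmetric] In_def[symmetric] P_in Q_in
    using side[OF conn(1) off(1)] side[OF conn(2) off(2)] by metis
qed

end

text \<open>The colour \<open>s\<close> records the side on which a chord is drawn. With ends given
  by their positions, alternation is a chain of inequalities, and non-planarity follows from any set
  of chords whose crossings admit no 2-colouring.\<close>

lemma planar_crossing_chords:
  fixes V :: "'v set"
  assumes "planar V E" and vs: "distinct vs" "set vs \<subseteq> V" "cycle_edges vs \<subseteq> E"
  shows "\<exists>s :: 'v set \<Rightarrow> bool. \<forall>i j k l. i < j \<longrightarrow> j < k \<longrightarrow> k < l \<longrightarrow> l < length vs \<longrightarrow>
    {vs ! i, vs ! k} \<in> E \<longrightarrow> {vs ! j, vs ! l} \<in> E \<longrightarrow> s {vs ! i, vs ! k} \<noteq> s {vs ! j, vs ! l}"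
proof -
  obtain pos \<gamma> where "drawing V E pos \<gamma>"
    using assms(1) planar_iff_drawing by blast
  then interpret drawing V E pos \<gamma> .
  define s where "s e \<longleftrightarrow> path_image (\<gamma> e) \<inter> inside (picture (cycle_edges vs)) = {}" for e
  have "s {vs ! i, vs ! k} \<noteq> s {vs ! j, vs ! l}"
    if "i < j" "j < k" "k < l" "l < length vs" "{vs ! i, vs ! k} \<in> E" "{vs ! j, vs ! l} \<in> E"
    for i j k l
  proof -
    \<comment> \<open>Cutting at the ends \<open>i\<close> and \<open>k\<close> of the first chord
      puts position \<open>j\<close> into the arc \<open>q\<close> and position \<open>l\<close>
      into the arc \<open>r @ p\<close>.\<close>
    define p q r where "p = take i vs" and "q = drop (Suc i) (take k vs)" and "r = drop (Suc k) vs"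
    have eq: "vs = p @ vs ! i # q @ vs ! k # r"
    proof -
      have "take k vs = p @ vs ! i # q"
        using id_take_nth_drop[of i "take k vs"] that by (simp add: p_def q_def min_def)
      then show ?thesis
        using id_take_nth_drop[of k vs] that by (simp add: r_def)
    qed
    have "q ! (j - Suc i) = vs ! j" "j - Suc i < length q"
      using that by (auto simp: q_def)
    then have j: "vs ! j \<in> set q"
      by (metis nth_mem)
    have "r ! (l - Suc k) = vs ! l" "l - Suc k < length r"
      using that by (auto simp: r_def)
    then have "vs ! l \<in> set r"
      by (metis nth_mem)
    then have l: "vs ! l \<in> set (r @ p)"
      by simp
    have "distinct (p @ vs ! i # q @ vs ! k # r)" "set (p @ vs ! i # q @ vs ! k # r) \<subseteq> V"
      "cycle_edges (p @ vs ! i # q @ vs ! k # r) \<subseteq> E"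
      using vs eq by simp_all
    from crossing_chords[OF this j l that(5,6)] show ?thesis
      unfolding s_def using eq by simp
  qed
  then show ?thesis
    by (intro exI[of _ s] allI impI)
qed

lemma nonplanar_K5:
  assumes "distinct [a, b, c, d, e]" "{a, b, c, d, e} \<subseteq> V"
    and E: "\<And>x y. x \<in> {a, b, c, d, e} \<Longrightarrow> y \<in> {a, b, c, d, e} \<Longrightarrow> x \<noteq> y \<Longrightarrow> {x, y} \<in> E"
  shows "\<not> planar V E"
proof
  assume "planar V E"
  define vs where "vs = [a, b, c, d, e]"
  have E': "{a, b} \<in> E" "{b, c} \<in> E" "{c, d} \<in> E" "{d, e} \<in> E" "{e, a} \<in> E"
    "{a, c} \<in> E" "{a, d} \<in> E" "{b, d} \<in> E" "{b, e} \<in> E" "{c, e} \<in> E"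
    by (rule E; use assms(1) in auto)+
  have vs: "distinct vs" "set vs \<subseteq> V" "cycle_edges vs \<subseteq> E"
    using assms(1,2) E' by (auto simp: vs_def cycle_edges_def)
  from planar_crossing_chords[OF \<open>planar V E\<close> vs] obtain s :: "'a set \<Rightarrow> bool" where
    s: "\<forall>i j k l. i < j \<longrightarrow> j < k \<longrightarrow> k < l \<longrightarrow> l < length vs \<longrightarrow>
      {vs ! i, vs ! k} \<in> E \<longrightarrow> {vs ! j, vs ! l} \<in> E \<longrightarrow> s {vs ! i, vs ! k} \<noteq> s {vs ! j, vs ! l}" ..
  \<comment> \<open>In the cyclic order ac, bd, ce, ad, be, neighbouring chords cross; an odd cycle
    has no proper 2-colouring.\<close>
  have "s {a, c} \<noteq> s {b, d}" "s {a, c} \<noteq> s {b, e}" "s {a, d} \<noteq> s {b, e}" "s {a, d} \<noteq> s {c, e}"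
    "s {b, d} \<noteq> s {c, e}"
    using s[rule_format, of 0 1 2 3] s[rule_format, of 0 1 2 4] s[rule_format, of 0 1 3 4]
      s[rule_format, of 0 2 3 4] s[rule_format, of 1 2 3 4] E'
    by (simp_all add: vs_def)
  then show False
    by auto
qed

section \<open>Planarity and subdivisions\<close>

text \<open>An edge in \<open>D\<close> is drawn along the path of length two through its own new
  vertex \<open>w e\<close>, any other edge along its image. The choice \<open>D = {}\<close> covers
  plain subgraph embeddings.\<close>

lemma planar_subdivision:
  fixes f :: "'a \<Rightarrow> 'b" and w :: "'a set \<Rightarrow> 'b"
  assumes "planar V' E'" and inj: "inj_on f V" and fV: "f ` V \<subseteq> V'"
    and edges: "\<And>e. e \<in> E \<Longrightarrow> \<exists>u\<in>V. \<exists>v\<in>V. u \<noteq> v \<and> e = {u, v}"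
    and direct: "\<And>e. e \<in> E \<Longrightarrow> e \<notin> D \<Longrightarrow> f ` e \<in> E'"
    and subdivided: "\<And>e x. e \<in> E \<Longrightarrow> e \<in> D \<Longrightarrow> x \<in> e \<Longrightarrow> {f x, w e} \<in> E'"
    and w: "\<And>e. e \<in> E \<Longrightarrow> e \<in> D \<Longrightarrow> w e \<in> V' - f ` V" "inj_on w (E \<inter> D)"
  shows "planar V E"
proof -
  obtain pos \<gamma> where "drawing V' E' pos \<gamma>"
    using assms(1) planar_iff_drawing by blast
  then interpret drawing V' E' pos \<gamma> .
  define S where "S e = (if e \<in> D then (\<lambda>x. {f x, w e}) ` e else {f ` e})" for e
  have S: "S e \<subseteq> E'" if "e \<in> E" for e
    using direct subdivided that by (auto simp: S_def)
  have eV: "e \<subseteq> V" if "e \<in> E" for e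
    using edges[OF that] by auto
  have "\<exists>g. arc g \<and> {pathstart g, pathfinish g} = (pos \<circ> f) ` e \<and> path_image g = picture (S e)"
    if e: "e \<in> E" for e
  proof -
    obtain u v where uv: "u \<in> V" "v \<in> V" "u \<noteq> v" "e = {u, v}"
      using edges[OF e] by blast
    have fuv: "f u \<noteq> f v" "f u \<in> V'" "f v \<in> V'"
      using uv inj fV by (auto dest: inj_onD)
    show ?thesis
    proof (cases "e \<in> D")
      case True
      have "w e \<noteq> f u" "w e \<noteq> f v" "w e \<in> V'"
        using w(1)[OF e True] uv by auto
      moreover have "{f u, w e} \<in> E'" "{w e, f v} \<in> E'"
        using subdivided[OF e True] uv by (auto simp: insert_commute)
      ultimately obtain g where "arc g" "pathstart g = pos (hd [f u, w e, f v])"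
        "pathfinish g = pos (last [f u, w e, f v])"
        "path_image g = picture (path_edges [f u, w e, f v])"
        using fuv path_arc[of "[f u, w e, f v]"] by auto
      then show ?thesis
        using True uv by (intro exI[of _ g]) (auto simp: S_def insert_commute)
    next
      case False
      then have "{f u, f v} \<in> E'"
        using direct e uv by fastforce
      then obtain g where "arc g" "pathstart g = pos (f u)" "pathfinish g = pos (f v)"
        "path_image g = path_image (\<gamma> {f u, f v})"
        using edge_arc_from fuv by metis
      then show ?thesis
        using False uv by (intro exI[of _ g]) (auto simp: S_def)
    qed
  qed
  then obtain g where g: "\<And>e. e \<in> E \<Longrightarrow> arc (g e)"
    "\<And>e. e \<in> E \<Longrightarrow> {pathstart (g e), pathfinish (g e)} = (pos \<circ> f) ` e"
    "\<And>e. e \<in> E \<Longrightarrow> path_image (g e) = picture (S e)"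
    by metis
  have SU: "\<Union>(S e) \<subseteq> f ` e \<union> (if e \<in> D then {w e} else {})" for e
    by (auto simp: S_def)
  have "drawing V E (pos \<circ> f) g"
  proof
    show "inj_on (pos \<circ> f) V"
      using inj inj_pos fV by (meson comp_inj_on inj_on_subset)
    show "v \<in> e" if ev: "e \<in> E" "v \<in> V" "(pos \<circ> f) v \<in> path_image (g e)" for e v
    proof -
      obtain d where d: "d \<in> S e" "pos (f v) \<in> path_image (\<gamma> d)"
        using ev(3) g(3)[OF ev(1)] by auto
      then have "f v \<in> d"
        using vertex_on_edge[of d "f v"] S[OF ev(1)] fV ev(2) by auto
      then have "f v \<in> f ` e \<union> (if e \<in> D then {w e} else {})"
        using SU d(1) by blast
      moreover have "f v \<noteq> w e" if "e \<in> D"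
        using w(1)[OF ev(1) that] ev(2) by (metis DiffD2 imageI)
      ultimately have "f v \<in> f ` e"
        by (auto split: if_splits)
      then show ?thesis
        using inj eV[OF ev(1)] ev(2) by (auto dest: inj_onD)
    qed
    show "path_image (g e) \<inter> path_image (g e') \<subseteq> (pos \<circ> f) ` (e \<inter> e')"
      if e: "e \<in> E" "e' \<in> E" "e \<noteq> e'" for e e'
    proof -
      have wf: "w a \<notin> f ` b" if "a \<in> E" "a \<in> D" "b \<in> E" for a b
        using w(1)[OF that(1,2)] eV[OF that(3)] by auto
      have ww: "w e \<noteq> w e'" if "e \<in> D" "e' \<in> D"
        using w(2) e that by (auto dest: inj_onD)
      have ff: "f ` e \<noteq> f ` e'"
        using inj_on_image_eq_iff[OF inj eV[OF e(1)] eV[OF e(2)]] e by simp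
      \<comment> \<open>Different edges have disjoint carriers \<open>S e\<close>: a half edge
        contains a middle vertex, which is no image under \<open>f\<close> and belongs to one edge
        only, and unsubdivided edges have different images because \<open>f\<close> is
        injective.\<close>
      have "d \<noteq> d'" if d: "d \<in> S e" "d' \<in> S e'" for d d'
      proof
        assume "d = d'"
        consider "e \<in> D" "e' \<in> D" | "e \<in> D" "e' \<notin> D" | "e \<notin> D" "e' \<in> D" | "e \<notin> D" "e' \<notin> D"
          by blast
        then show False
        proof cases
          case 1
          then obtain x x' where "d = {f x, w e}" "x \<in> e" "d' = {f x', w e'}" "x' \<in> e'"
            using d by (auto simp: S_def)
          then show False
            using \<open>d = d'\<close> ww[OF 1] wf[OF e(1) 1(1) e(2)] by (metis doubleton_eq_iff imageI)
        next
          case 2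
          then have "w e \<in> d" "d' = f ` e'"
            using d by (auto simp: S_def)
          then show False
            using \<open>d = d'\<close> 2 wf[of e e'] e by blast
        next
          case 3
          then have "w e' \<in> d'" "d = f ` e"
            using d by (auto simp: S_def)
          then show False
            using \<open>d = d'\<close> 3 wf[of e' e] e by blast
        next
          case 4
          then show False
            using d \<open>d = d'\<close> ff by (simp add: S_def)
        qed
      qed
      then have "S e \<inter> S e' = {}"
        by blast
      then have "picture (S e) \<inter> picture (S e') \<subseteq> pos ` (\<Union>(S e) \<inter> \<Union>(S e'))"
        by (intro picture_meet S e)
      also have "\<dots> \<subseteq> pos ` (f ` e \<inter> f ` e')"
      proof (rule image_mono)
        have "\<Union>(S e) \<inter> \<Union>(S e') \<subseteq>
            (f ` e \<union> (if e \<in> D then {w e} else {})) \<inter> (f ` e' \<union> (if e' \<in> D then {w e'} else {}))"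
          by (intro Int_mono SU)
        also have "\<dots> \<subseteq> f ` e \<inter> f ` e'"
          using wf[of e e'] wf[of e' e] e ww by auto
        finally show "\<Union>(S e) \<inter> \<Union>(S e') \<subseteq> f ` e \<inter> f ` e'" .
      qed
      also have "f ` e \<inter> f ` e' = f ` (e \<inter> e')"
        using inj_on_image_Int[OF inj eV[OF e(1)] eV[OF e(2)]] by simp
      finally show ?thesis
        using g(3) e by (simp add: image_comp)
    qed
    show "arc (g e)" "{pathstart (g e), pathfinish (g e)} = (pos \<circ> f) ` e" if "e \<in> E" for e
      using g(1,2)[OF that] by this+
  qed
  then show ?thesis
    using planar_iff_drawing by blast
qed

section \<open>Moves, complements and embeddings of token graphs\<close>

text \<open>An edge is the move of one token between \<open>a\<close> and \<open>b\<close> while the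
  tokens on \<open>X\<close> rest. The two differences of the ends have equal size and one or two
  elements in total, hence one each.\<close>

lemma token_edge_iff:
  assumes "finite V"
  shows "e \<in> token_edges V E k \<longleftrightarrow> (\<exists>X a b. X \<subseteq> V \<and> a \<in> V - X \<and> b \<in> V - X \<and> a \<noteq> b \<and>
    Suc (card X) = k \<and> {a, b} \<in> E \<and> e = {insert a X, insert b X})"
proof
  assume "e \<in> token_edges V E k"
  then obtain A B a b where AB: "e = {A, B}" "A \<subseteq> V" "B \<subseteq> V" "card A = k" "card B = k"
    "A - B \<union> (B - A) = {a, b}" "{a, b} \<in> E"
    by (auto simp: token_edges_def token_vertices_def)
  have fin: "finite A" "finite B"
    using AB assms finite_subset by auto
  have c: "card A = card (A \<inter> B) + card (A - B)" "card B = card (A \<inter> B) + card (B - A)"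
    using fin card_Int_Diff by (metis, metis Int_commute)
  then have eq: "card (A - B) = card (B - A)"
    using AB by simp
  have disj: "(A - B) \<inter> (B - A) = {}"
    by auto
  have sum: "card {a, b} = card (A - B) + card (B - A)"
    using card_Un_disjoint[OF _ _ disj] fin AB(6) by simp
  \<comment> \<open>The definition leaves \<open>a = b\<close> open, so only these bounds are at
    hand; the sum of two equal numbers is even, hence 2.\<close>
  moreover have "0 < card {a, b}" "card {a, b} \<le> 2"
    by (auto simp: card_gt_0_iff card_insert_if)
  ultimately have one: "card (A - B) = 1" "card (B - A) = 1"
    using eq by linarith+
  then obtain x y where xy: "A - B = {x}" "B - A = {y}"
    by (meson card_1_singletonE)
  define X where "X = A \<inter> B"
  have "{x, y} = {a, b}"
    using AB(6) xy by (simp add: insert_commute)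
  moreover have "A = insert x X" "B = insert y X" "x \<notin> X" "y \<notin> X" "x \<noteq> y"
    using xy by (auto simp: X_def)
  moreover have "Suc (card X) = k"
    using c one AB by (simp add: X_def)
  ultimately have "X \<subseteq> V \<and> x \<in> V - X \<and> y \<in> V - X \<and> x \<noteq> y \<and>
    Suc (card X) = k \<and> {x, y} \<in> E \<and> e = {insert x X, insert y X}"
    using AB by simp
  then show "\<exists>X a b. X \<subseteq> V \<and> a \<in> V - X \<and> b \<in> V - X \<and> a \<noteq> b \<and>
    Suc (card X) = k \<and> {a, b} \<in> E \<and> e = {insert a X, insert b X}"
    by blast
next
  assume "\<exists>X a b. X \<subseteq> V \<and> a \<in> V - X \<and> b \<in> V - X \<and> a \<noteq> b \<and>
    Suc (card X) = k \<and> {a, b} \<in> E \<and> e = {insert a X, insert b X}"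
  then obtain X a b where X: "X \<subseteq> V" "a \<in> V - X" "b \<in> V - X" "a \<noteq> b" "Suc (card X) = k"
    "{a, b} \<in> E" "e = {insert a X, insert b X}"
    by blast
  have "finite X"
    using X assms finite_subset by blast
  then have "insert a X \<in> token_vertices V k" "insert b X \<in> token_vertices V k"
    using X by (auto simp: token_vertices_def)
  moreover have "insert a X - insert b X \<union> (insert b X - insert a X) = {a, b}"
    using X by blast
  ultimately show "e \<in> token_edges V E k"
    unfolding token_edges_def using X(6,7) by blast
qed

lemma token_edgeI:
  assumes "finite V" "X \<subseteq> V" "a \<in> V - X" "b \<in> V - X" "a \<noteq> b" "Suc (card X) = k" "{a, b} \<in> E"
  shows "{insert a X, insert b X} \<in> token_edges V E k"
  unfolding token_edge_iff[OF assms(1)] using assms(2-)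
  by (intro exI[of _ X] exI[of _ a] exI[of _ b] conjI refl)

lemma token_edgeE:
  assumes "e \<in> token_edges V E k" "finite V"
  obtains X a b where "X \<subseteq> V" "a \<in> V - X" "b \<in> V - X" "a \<noteq> b" "Suc (card X) = k" "{a, b} \<in> E"
    "e = {insert a X, insert b X}"
  using assms(1) unfolding token_edge_iff[OF assms(2)] by (elim exE conjE)

lemma token_edge_endpoints:
  assumes "e \<in> token_edges V E k" "finite V"
  shows "\<exists>A\<in>token_vertices V k. \<exists>B\<in>token_vertices V k. A \<noteq> B \<and> e = {A, B}"
  using assms
proof (rule token_edgeE)
  fix X a b
  assume X: "X \<subseteq> V" "a \<in> V - X" "b \<in> V - X" "a \<noteq> b" "Suc (card X) = k" "e = {insert a X, insert b X}"
  then have "finite X"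
    using assms(2) finite_subset by blast
  moreover have "insert a X \<noteq> insert b X"
    using X by blast
  ultimately show ?thesis
    using X by (intro bexI[of _ "insert a X"] bexI[of _ "insert b X"]) (auto simp: token_vertices_def)
qed

text \<open>Complementation exchanges tokens and holes: a token moving from \<open>a\<close> to
  \<open>b\<close> is a hole moving from \<open>b\<close> to \<open>a\<close>.\<close>

lemma planar_token_complement:
  assumes "planar (token_vertices V k) (token_edges V E k)" "finite V" "k \<le> card V"
  shows "planar (token_vertices V (card V - k)) (token_edges V E (card V - k))"
proof (rule planar_subdivision[OF assms(1), where f = "\<lambda>A. V - A" and D = "{}"])
  show "inj_on (\<lambda>A. V - A) (token_vertices V (card V - k))"
    by (auto simp: inj_on_def token_vertices_def)
  show "(\<lambda>A. V - A) ` token_vertices V (card V - k) \<subseteq> token_vertices V k"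
    using assms by (auto simp: token_vertices_def card_Diff_subset finite_subset)
  fix e
  assume "e \<in> token_edges V E (card V - k)"
  then show "\<exists>A\<in>token_vertices V (card V - k). \<exists>B\<in>token_vertices V (card V - k). A \<noteq> B \<and> e = {A, B}"
    using assms token_edge_endpoints by blast
  assume "e \<in> token_edges V E (card V - k)"
  then show "(\<lambda>A. V - A) ` e \<in> token_edges V E k"
    using assms(2)
  proof (rule token_edgeE)
    fix X a b
    assume X: "X \<subseteq> V" "a \<in> V - X" "b \<in> V - X" "a \<noteq> b" "Suc (card X) = card V - k" "{a, b} \<in> E"
      "e = {insert a X, insert b X}"
    \<comment> \<open>The resting part of the complementary move: all places other than
      \<open>a\<close>, \<open>b\<close> and those in \<open>X\<close>.\<close>
    define Y where "Y = V - insert a (insert b X)"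
    have "finite X"
      using X assms(2) finite_subset by blast
    then have "card (insert a (insert b X)) = Suc (Suc (card X))"
      using X by simp
    moreover have "insert a (insert b X) \<subseteq> V"
      using X by auto
    ultimately have "card Y = card V - Suc (Suc (card X))"
      "Suc (Suc (card X)) \<le> card V"
      unfolding Y_def using card_Diff_subset[of "insert a (insert b X)" V] \<open>finite X\<close>
        card_mono[OF assms(2), of "insert a (insert b X)"] by auto
    then have "Suc (card Y) = k"
      using X(5) assms(3) by linarith
    moreover have "(\<lambda>A. V - A) ` e = {insert b Y, insert a Y}"
      using X by (auto simp: Y_def)
    moreover have "{insert b Y, insert a Y} \<in> token_edges V E k" if "Suc (card Y) = k"
      by (rule token_edgeI) (use X assms(2) that in \<open>auto simp: Y_def insert_commute\<close>)
    ultimately show ?thesis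
      by simp
  qed
qed auto

text \<open>The surplus tokens are frozen on \<open>S\<close>, outside the copy of
  \<open>V'\<close>; the other \<open>j\<close> tokens move inside the copy.\<close>

lemma planar_token_embed:
  assumes "planar (token_vertices V k) (token_edges V E k)" "finite V" and h: "inj_on h V'" "h ` V' \<subseteq> V"
    and E': "\<And>u v. u \<in> V' \<Longrightarrow> v \<in> V' \<Longrightarrow> {u, v} \<in> E' \<Longrightarrow> {h u, h v} \<in> E"
    and S: "S \<subseteq> V - h ` V'" "k = j + card S"
  shows "planar (token_vertices V' j) (token_edges V' E' j)"
proof (rule planar_subdivision[OF assms(1), where f = "\<lambda>A. h ` A \<union> S" and D = "{}"])
  have fin: "finite V'" "finite S"
    using assms(2) h S finite_subset inj_on_finite by (metis, metis Diff_subset)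
  have card_im: "card (h ` A \<union> S) = card A + card S" if "A \<subseteq> V'" for A
  proof -
    have "card (h ` A \<union> S) = card (h ` A) + card S"
      using that fin S by (intro card_Un_disjoint) (auto intro: finite_subset)
    then show ?thesis
      using that h by (metis card_image inj_on_subset)
  qed
  show "inj_on (\<lambda>A. h ` A \<union> S) (token_vertices V' j)"
  proof (rule inj_onI)
    fix A B
    assume AB: "A \<in> token_vertices V' j" "B \<in> token_vertices V' j" "h ` A \<union> S = h ` B \<union> S"
    then have "A \<subseteq> V'" "B \<subseteq> V'"
      by (auto simp: token_vertices_def)
    moreover from this have "h ` A = h ` B"
      using AB(3) S by blast
    ultimately show "A = B"
      using h inj_on_image_eq_iff by metis
  qed
  show "(\<lambda>A. h ` A \<union> S) ` token_vertices V' j \<subseteq> token_vertices V k"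
  proof clarify
    fix A
    assume A: "A \<in> token_vertices V' j"
    then have "h ` A \<union> S \<subseteq> V"
      using h(2) S(1) by (fastforce simp: token_vertices_def)
    then show "h ` A \<union> S \<in> token_vertices V k"
      using A S(2) card_im by (simp add: token_vertices_def)
  qed
  fix e
  assume "e \<in> token_edges V' E' j"
  then show "\<exists>A\<in>token_vertices V' j. \<exists>B\<in>token_vertices V' j. A \<noteq> B \<and> e = {A, B}"
    using fin token_edge_endpoints by blast
  assume "e \<in> token_edges V' E' j"
  then show "(\<lambda>A. h ` A \<union> S) ` e \<in> token_edges V E k"
    using fin(1)
  proof (rule token_edgeE)
    fix X a b
    assume X: "X \<subseteq> V'" "a \<in> V' - X" "b \<in> V' - X" "a \<noteq> b" "Suc (card X) = j" "{a, b} \<in> E'"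
      "e = {insert a X, insert b X}"
    have "{insert (h a) (h ` X \<union> S), insert (h b) (h ` X \<union> S)} \<in> token_edges V E k"
    proof (rule token_edgeI)
      show "h a \<in> V - (h ` X \<union> S)" "h b \<in> V - (h ` X \<union> S)" "h a \<noteq> h b"
        using X h(2) S(1) inj_on_image_mem_iff[OF h(1) X(2)[THEN DiffD1] X(1)]
          inj_on_image_mem_iff[OF h(1) X(3)[THEN DiffD1] X(1)] inj_on_eq_iff[OF h(1), of a b] by blast+
      show "h ` X \<union> S \<subseteq> V"
        using X(1) h(2) S(1) by blast
      show "{h a, h b} \<in> E"
        using E' X by blast
    qed (use X(5) S(2) card_im[OF X(1)] assms(2) in auto)
    then show ?thesis
      using X by simp
  qed
qed auto

text \<open>Enough tokens can be frozen outside the copy of \<open>V'\<close> to leave at least two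
  tokens and two holes inside it. So it suffices to study the small graph for all such numbers of
  tokens.\<close>

lemma nonplanar_token_embed:
  assumes "finite V" and h: "inj_on h V'" "h ` V' \<subseteq> V"
    and E': "\<And>u v. u \<in> V' \<Longrightarrow> v \<in> V' \<Longrightarrow> {u, v} \<in> E' \<Longrightarrow> {h u, h v} \<in> E"
    and np: "\<And>j. 2 \<le> j \<Longrightarrow> j + 2 \<le> card V' \<Longrightarrow>
      \<not> planar (token_vertices V' j) (token_edges V' E' j)"
    and k: "2 \<le> k" "k + 2 \<le> card V" and "4 \<le> card V'"
  shows "\<not> planar (token_vertices V k) (token_edges V E k)"
proof
  assume pl: "planar (token_vertices V k) (token_edges V E k)"
  have cd: "card (V - h ` V') = card V - card V'" and le: "card V' \<le> card V"
    using h assms(1) by (auto simp: card_Diff_subset card_image finite_subset card_inj_on_le)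
  \<comment> \<open>As many tokens as possible go outside the copy, but two are kept inside; if all
    of them would fit outside, the truncated difference is 0. Two holes remain inside by
    \<open>k + 2 \<le> card V\<close> or, when \<open>j = 2\<close>, by
    \<open>4 \<le> card V'\<close>.\<close>
  define j where "j = max 2 (k - (card V - card V'))"
  have j: "2 \<le> j" "j + 2 \<le> card V'" "j \<le> k" "k - j \<le> card (V - h ` V')"
    using k assms(8) cd le by (auto simp: j_def)
  obtain S where "S \<subseteq> V - h ` V'" "card S = k - j"
    using obtain_subset_with_card_n[OF j(4)] by metis
  then show False
    using planar_token_embed[where S = S and j = j, OF pl assms(1) h E'] np[OF j(1,2)] j(3) by simp
qed

section \<open>Token graphs of the star with five leaves\<close>

definition star_edges :: "nat \<Rightarrow> nat set set" where
  "star_edges m = (\<lambda>i. {0, i}) ` {1..m}"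

text \<open>Vertex \<open>i\<close> of \<open>K\<^sub>5\<close> becomes the configuration with
  tokens on the centre and on leaf \<open>i\<close>. The edge \<open>{i, j}\<close> is subdivided by
  the configuration with tokens on leaves \<open>i\<close> and \<open>j\<close>, which is the set
  \<open>{i, j}\<close> itself; so \<open>w\<close> is the identity.\<close>

lemma nonplanar_star_two_tokens: "\<not> planar (token_vertices {..5} 2) (token_edges {..5} (star_edges 5) 2)"
proof
  assume pl: "planar (token_vertices {..5} 2) (token_edges {..5} (star_edges 5) 2)"
  define K where "K = {{i, j} | i j :: nat. i \<in> {1..5} \<and> j \<in> {1..5} \<and> i \<noteq> j}"
  have "planar {1..5::nat} K"
  proof (rule planar_subdivision[OF pl, where f = "\<lambda>i. {0, i}" and w = "\<lambda>e. e" and D = UNIV])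
    show "inj_on (\<lambda>i. {0, i}) {1..5::nat}"
      by (auto simp: inj_on_def doubleton_eq_iff)
    show "(\<lambda>i. {0, i}) ` {1..5} \<subseteq> token_vertices {..5::nat} 2"
      by (auto simp: token_vertices_def)
    fix e
    assume "e \<in> K"
    then obtain i j where ij: "i \<in> {1..5}" "j \<in> {1..5}" "i \<noteq> j" "e = {i, j}"
      by (auto simp: K_def)
    then show "\<exists>u\<in>{1..5}. \<exists>v\<in>{1..5}. u \<noteq> v \<and> e = {u, v}"
      by blast
    show "e \<in> token_vertices {..5} 2 - (\<lambda>i. {0, i}) ` {1..5}"
      using ij by (auto simp: token_vertices_def doubleton_eq_iff)
    have *: "{{0, x}, {x, y}} \<in> token_edges {..5} (star_edges 5) 2"
      if "x \<in> {1..5}" "y \<in> {1..5}" "x \<noteq> y" for x y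
    proof -
      have "{insert 0 {x}, insert y {x}} \<in> token_edges {..5} (star_edges 5) 2"
        by (rule token_edgeI) (use that in \<open>auto simp: star_edges_def\<close>)
      then show ?thesis
        by (simp add: insert_commute)
    qed
    fix x
    assume "x \<in> e"
    then show "{{0, x}, e} \<in> token_edges {..5} (star_edges 5) 2"
      using *[of i j] *[of j i] ij by (auto simp: insert_commute)
  qed auto
  moreover have "\<not> planar {1..5::nat} K"
  proof (rule nonplanar_K5[of 1 2 3 4 5])
    show "{x, y} \<in> K" if "x \<in> {1, 2, 3, 4, 5}" "y \<in> {1, 2, 3, 4, 5}" "x \<noteq> y" for x y
    proof -
      have "x \<in> {1..5}" "y \<in> {1..5}"
        using that by auto
      then show ?thesis
        using that(3) unfolding K_def by blast
    qed
  qed auto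
  ultimately show False
    by simp
qed

text \<open>The graph is the Desargues graph; the cycle of length 14 below has three pairwise crossing
  chords, which gives a subdivided \<open>K\<^sub>3\<^sub>,\<^sub>3\<close>.\<close>

lemma nonplanar_star_three_tokens:
  "\<not> planar (token_vertices {..5} 3) (token_edges {..5} (star_edges 5) 3)"
proof
  assume pl: "planar (token_vertices {..5} 3) (token_edges {..5} (star_edges 5) 3)"
  \<comment> \<open>Every move has the centre \<open>0\<close> as one end, so configurations with
    and without a token on \<open>0\<close> alternate along the cycle.\<close>
  define vs :: "nat set list" where "vs = [{0,1,2}, {1,2,3}, {0,1,3}, {1,3,4}, {0,1,4}, {1,2,4},
    {0,2,4}, {2,3,4}, {0,2,3}, {2,3,5}, {0,3,5}, {1,3,5}, {0,1,5}, {1,2,5}]"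
  let ?E = "token_edges {..5} (star_edges 5) 3"
  have edge: "{{0, x, y}, {x, y, z}} \<in> ?E" if "distinct [0, x, y, z]" "{x, y, z} \<subseteq> {..5}" for x y z
  proof -
    have "{insert 0 {x, y}, insert z {x, y}} \<in> ?E"
      by (rule token_edgeI) (use that in \<open>auto simp: star_edges_def\<close>)
    then show ?thesis
      by (simp add: insert_commute)
  qed
  have "distinct vs"
    unfolding vs_def by code_simp
  moreover have "set vs \<subseteq> token_vertices {..5} 3"
    by (simp add: vs_def token_vertices_def)
  moreover have "cycle_edges vs \<subseteq> ?E"
    using edge[of 1 2 3] edge[of 1 3 2] edge[of 1 3 4] edge[of 1 4 3] edge[of 1 4 2] edge[of 2 4 1]
      edge[of 2 4 3] edge[of 2 3 4] edge[of 2 3 5] edge[of 3 5 2] edge[of 3 5 1] edge[of 1 5 3]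
      edge[of 1 5 2] edge[of 1 2 5]
    by (simp add: vs_def cycle_edges_def insert_commute)
  ultimately obtain s :: "nat set set \<Rightarrow> bool" where
    s: "\<forall>i j k l. i < j \<longrightarrow> j < k \<longrightarrow> k < l \<longrightarrow> l < length vs \<longrightarrow>
      {vs ! i, vs ! k} \<in> ?E \<longrightarrow> {vs ! j, vs ! l} \<in> ?E \<longrightarrow> s {vs ! i, vs ! k} \<noteq> s {vs ! j, vs ! l}"
    using planar_crossing_chords[OF pl] by metis
  \<comment> \<open>The first ends, at 0, 1, 2, and the second ends, at 5, 8, 11, appear in the same
    order, so the chords cross pairwise; two sides are too few for three of them.\<close>
  have "{vs ! 0, vs ! 5} \<in> ?E" "{vs ! 1, vs ! 8} \<in> ?E" "{vs ! 2, vs ! 11} \<in> ?E"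
    using edge[of 1 2 4] edge[of 2 3 1] edge[of 1 3 5] by (simp_all add: vs_def insert_commute)
  then have "s {vs ! 0, vs ! 5} \<noteq> s {vs ! 1, vs ! 8}" "s {vs ! 0, vs ! 5} \<noteq> s {vs ! 2, vs ! 11}"
    "s {vs ! 1, vs ! 8} \<noteq> s {vs ! 2, vs ! 11}"
    using s[rule_format, of 0 1 5 8] s[rule_format, of 0 2 5 11] s[rule_format, of 1 2 8 11]
    by (simp_all add: vs_def)
  then show False
    by auto
qed

lemma nonplanar_star:
  assumes "2 \<le> j" "j + 2 \<le> card {..5::nat}"
  shows "\<not> planar (token_vertices {..5} j) (token_edges {..5} (star_edges 5) j)"
proof -
  consider "j = 2" | "j = 3" | "j = 4"
    using assms by fastforce
  then show ?thesis
  proof cases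
    case 3
    then show ?thesis
      using planar_token_complement[of "{..5::nat}" 4 "star_edges 5"] nonplanar_star_two_tokens by auto
  qed (use nonplanar_star_two_tokens nonplanar_star_three_tokens in auto)
qed

section \<open>Token graphs of cycles\<close>

text \<open>The closing edge is kept apart from the consecutive pairs because it is the one
  subdivided in passing from \<open>m\<close> to \<open>Suc m\<close>.\<close>

definition circular_edges :: "nat \<Rightarrow> nat set set" where
  "circular_edges m = insert {0, m - 1} ((\<lambda>i. {i, Suc i}) ` {..<m - 1})"

text \<open>The graph is a subdivided \<open>K\<^sub>5\<close>. Its branch vertices are the five
  pairs at distance two, at the even positions of \<open>vs\<close>; the pairs of neighbours, at the
  odd positions, subdivide the edges of a Hamiltonian cycle of \<open>K\<^sub>5\<close>.\<close>

lemma nonplanar_pentagon: "\<not> planar (token_vertices {..<5} 2) (token_edges {..<5} (circular_edges 5) 2)"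
proof
  assume pl: "planar (token_vertices {..<5} 2) (token_edges {..<5} (circular_edges 5) 2)"
  let ?E = "token_edges {..<5} (circular_edges 5) 2"
  have C: "circular_edges 5 = {{0, 4}, {0, 1}, {1, 2}, {2, 3}, {3, 4}}"
    by (auto simp: circular_edges_def numeral_eq_Suc lessThan_Suc)
  define vs :: "nat set list" where "vs = [{0,2}, {1,2}, {1,3}, {2,3}, {2,4}, {3,4}, {0,3}, {0,4},
    {1,4}, {0,1}]"
  have edge: "{{x, z}, {y, z}} \<in> ?E" if "{x, y} \<in> circular_edges 5" "distinct [x, y, z]"
    "{x, y, z} \<subseteq> {..<5}" for x y z
    using token_edgeI[of "{..<5}" "{z}" x y 2 "circular_edges 5"] that by auto
  have E: "{{0,2}, {1,2}} \<in> ?E" "{{1,2}, {1,3}} \<in> ?E" "{{1,3}, {2,3}} \<in> ?E" "{{2,3}, {2,4}} \<in> ?E"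
    "{{2,4}, {3,4}} \<in> ?E" "{{3,4}, {0,3}} \<in> ?E" "{{0,3}, {0,4}} \<in> ?E" "{{0,4}, {1,4}} \<in> ?E"
    "{{1,4}, {0,1}} \<in> ?E" "{{0,1}, {0,2}} \<in> ?E" "{{0,2}, {2,4}} \<in> ?E" "{{1,3}, {0,3}} \<in> ?E"
    "{{2,4}, {1,4}} \<in> ?E" "{{0,2}, {0,3}} \<in> ?E" "{{1,3}, {1,4}} \<in> ?E"
    using edge[of 0 1 2] edge[of 2 3 1] edge[of 1 2 3] edge[of 3 4 2] edge[of 2 3 4] edge[of 0 4 3]
      edge[of 3 4 0] edge[of 0 1 4] edge[of 0 4 1] edge[of 1 2 0] edge[of 0 4 2] edge[of 0 1 3]
      edge[of 1 2 4] edge[of 2 3 0] edge[of 3 4 1]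
    by (simp_all add: C doubleton_eq_iff insert_commute)
  have "distinct vs"
    by (simp add: vs_def doubleton_eq_iff)
  moreover have "set vs \<subseteq> token_vertices {..<5} 2"
    by (simp add: vs_def token_vertices_def)
  moreover have "cycle_edges vs \<subseteq> ?E"
    using E by (simp add: vs_def cycle_edges_def)
  ultimately obtain s :: "nat set set \<Rightarrow> bool" where
    s: "\<forall>i j k l. i < j \<longrightarrow> j < k \<longrightarrow> k < l \<longrightarrow> l < length vs \<longrightarrow>
      {vs ! i, vs ! k} \<in> ?E \<longrightarrow> {vs ! j, vs ! l} \<in> ?E \<longrightarrow> s {vs ! i, vs ! k} \<noteq> s {vs ! j, vs ! l}"
    using planar_crossing_chords[OF pl] by metis
  \<comment> \<open>These are the five unsubdivided edges; in the cyclic order 04, 26, 48, 06, 28 of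
    their positions, neighbouring ones cross.\<close>
  have "{vs ! 0, vs ! 4} \<in> ?E" "{vs ! 2, vs ! 6} \<in> ?E" "{vs ! 4, vs ! 8} \<in> ?E"
    "{vs ! 0, vs ! 6} \<in> ?E" "{vs ! 2, vs ! 8} \<in> ?E"
    using E by (simp_all add: vs_def)
  then have "s {vs ! 0, vs ! 4} \<noteq> s {vs ! 2, vs ! 6}" "s {vs ! 2, vs ! 6} \<noteq> s {vs ! 4, vs ! 8}"
    "s {vs ! 0, vs ! 6} \<noteq> s {vs ! 4, vs ! 8}" "s {vs ! 0, vs ! 6} \<noteq> s {vs ! 2, vs ! 8}"
    "s {vs ! 0, vs ! 4} \<noteq> s {vs ! 2, vs ! 8}"
    using s[rule_format, of 0 2 4 6] s[rule_format, of 2 4 6 8] s[rule_format, of 0 4 6 8]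
      s[rule_format, of 0 2 6 8] s[rule_format, of 0 2 4 8]
    by (simp_all add: vs_def)
  then show False
    by auto
qed

text \<open>The longer cycle arises by subdividing the edge \<open>{0, m - 1}\<close> with \<open>m\<close>; a token move along this
  edge becomes a path through the configuration with a token on \<open>m\<close>.\<close>

lemma planar_token_shorter_cycle:
  assumes pl: "planar (token_vertices {..<Suc m} j) (token_edges {..<Suc m} (circular_edges (Suc m)) j)"
    and "2 \<le> m"
  shows "planar (token_vertices {..<m} j) (token_edges {..<m} (circular_edges m) j)"
proof -
  let ?E' = "token_edges {..<Suc m} (circular_edges (Suc m)) j"
  \<comment> \<open>\<open>D\<close> holds the moves along \<open>{0, m - 1}\<close>. The ends of
    such a move intersect in the set \<open>X\<close> of resting tokens, so
    \<open>insert m (\<Inter>e)\<close> stops the moving token on the new vertex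
    \<open>m\<close>.\<close>
  define D where "D = {{insert 0 X, insert (m - 1) X} | X.
    X \<subseteq> {..<m} \<and> 0 \<notin> X \<and> m - 1 \<notin> X \<and> Suc (card X) = j}"
  have wD: "insert m (\<Inter>{insert 0 X, insert (m - 1) X}) = insert m X"
    if "X \<subseteq> {..<m}" "0 \<notin> X" "m - 1 \<notin> X" for X
    using that \<open>2 \<le> m\<close> by auto
  have fin: "finite X" "m \<notin> X" if "X \<subseteq> {..<m}" for X
    using that finite_subset by auto
  show ?thesis
  proof (rule planar_subdivision[OF pl, where f = "\<lambda>A. A" and w = "\<lambda>e. insert m (\<Inter>e)" and D = D])
    show "(\<lambda>A. A) ` token_vertices {..<m} j \<subseteq> token_vertices {..<Suc m} j"
      by (auto simp: token_vertices_def lessThan_Suc)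
    show "inj_on (\<lambda>e. insert m (\<Inter>e)) (token_edges {..<m} (circular_edges m) j \<inter> D)"
    proof (rule inj_onI)
      fix e e'
      assume e: "e \<in> token_edges {..<m} (circular_edges m) j \<inter> D"
        "e' \<in> token_edges {..<m} (circular_edges m) j \<inter> D" "insert m (\<Inter>e) = insert m (\<Inter>e')"
      obtain X where X: "e = {insert 0 X, insert (m - 1) X}" "X \<subseteq> {..<m}" "0 \<notin> X" "m - 1 \<notin> X"
        using e(1) by (auto simp: D_def)
      obtain Y where Y: "e' = {insert 0 Y, insert (m - 1) Y}" "Y \<subseteq> {..<m}" "0 \<notin> Y" "m - 1 \<notin> Y"
        using e(2) by (auto simp: D_def)
      have "insert m X = insert m Y"
        using e(3) wD X Y by metis
      then have "X = Y"
        using fin X(2) Y(2) by (metis insert_ident)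
      then show "e = e'"
        using X Y by simp
    qed
    fix e
    assume e: "e \<in> token_edges {..<m} (circular_edges m) j"
    then show "\<exists>u\<in>token_vertices {..<m} j. \<exists>v\<in>token_vertices {..<m} j. u \<noteq> v \<and> e = {u, v}"
      by (rule token_edge_endpoints) simp
    {
      assume "e \<notin> D"
      show "(\<lambda>A. A) ` e \<in> ?E'"
        using e finite_lessThan
      proof (rule token_edgeE)
        fix X a b
        assume X: "X \<subseteq> {..<m}" "a \<in> {..<m} - X" "b \<in> {..<m} - X" "a \<noteq> b" "Suc (card X) = j"
          "{a, b} \<in> circular_edges m" "e = {insert a X, insert b X}"
        have "{a, b} \<noteq> {0, m - 1}"
        proof
          assume "{a, b} = {0, m - 1}"
          then have "e = {insert 0 X, insert (m - 1) X} \<and> 0 \<notin> X \<and> m - 1 \<notin> X"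
            using X by (auto simp: doubleton_eq_iff)
          then show False
            using \<open>e \<notin> D\<close> X unfolding D_def by blast
        qed
        then have "{a, b} \<in> circular_edges (Suc m)"
          using X(6) by (auto simp: circular_edges_def)
        then have "{insert a X, insert b X} \<in> ?E'"
          using X by (intro token_edgeI) auto
        then show ?thesis
          using X by simp
      qed
    }
    assume "e \<in> D"
    then obtain X where X: "e = {insert 0 X, insert (m - 1) X}" "X \<subseteq> {..<m}" "0 \<notin> X" "m - 1 \<notin> X"
      "Suc (card X) = j"
      by (auto simp: D_def)
    have w: "insert m (\<Inter>e) = insert m X"
      using wD X by simp
    show "insert m (\<Inter>e) \<in> token_vertices {..<Suc m} j - (\<lambda>A. A) ` token_vertices {..<m} j"
      unfolding w using X(2,5) fin by (auto simp: token_vertices_def)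
    have "{0, m} \<in> circular_edges (Suc m)" "{m - 1, m} \<in> circular_edges (Suc m)"
      using \<open>2 \<le> m\<close> by (auto simp: circular_edges_def image_iff intro!: bexI[of _ "m - 1"])
    then have "{insert 0 X, insert m X} \<in> ?E'" "{insert (m - 1) X, insert m X} \<in> ?E'"
      using X \<open>2 \<le> m\<close> by (auto intro!: token_edgeI)
    moreover fix A
    assume "A \<in> e"
    ultimately show "{A, insert m (\<Inter>e)} \<in> ?E'"
      unfolding w using X(1) by blast
  qed auto
qed

text \<open>Subdivision passes from \<open>m\<close> to \<open>Suc m\<close> with the same number of
  tokens. Only the case of exactly two holes is new at \<open>Suc m\<close>, and complementation
  turns it into two tokens.\<close>

lemma nonplanar_token_cycle:
  assumes "5 \<le> m" "2 \<le> j" "j + 2 \<le> m"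
  shows "\<not> planar (token_vertices {..<m} j) (token_edges {..<m} (circular_edges m) j)"
  using assms
proof (induction m arbitrary: j rule: dec_induct)
  case base
  then consider "j = 2" | "j = 3"
    by linarith
  then show ?case
  proof cases
    case 2
    then show ?thesis
      using planar_token_complement[of "{..<5::nat}" 3 "circular_edges 5"] nonplanar_pentagon by auto
  qed (use nonplanar_pentagon in simp)
next
  case (step m)
  have *: "\<not> planar (token_vertices {..<Suc m} i) (token_edges {..<Suc m} (circular_edges (Suc m)) i)"
    if "2 \<le> i" "i + 2 \<le> m" for i
    using planar_token_shorter_cycle[of m i] step.IH[OF that] step.hyps by auto
  show ?case
  proof (cases "j + 2 \<le> m")
    case False
    then have "Suc m - j = 2"
      using step by linarith
    then show ?thesis
      using planar_token_complement[of "{..<Suc m}" j "circular_edges (Suc m)"] *[of 2] step by auto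
  qed (use * step in auto)
qed

section \<open>Stars and long cycles in an arbitrary graph\<close>

theorem theorem6:
  fixes V :: "'v set" and E :: "'v set set" and k :: nat
  assumes "simple_graph V E"
    and "2 \<le> k" and "k + 2 \<le> card V"
    and "max_degree V E \<ge> 5 \<or> circumference V E \<ge> 5"
  shows "\<not> planar (token_vertices V k) (token_edges V E k)"
proof -
  have finV: "finite V" and edgesV: "\<And>u v. {u, v} \<in> E \<Longrightarrow> u \<in> V \<and> v \<in> V \<and> u \<noteq> v"
    using assms(1) by (auto simp: simple_graph_def doubleton_eq_iff)
  from assms(4) show ?thesis
  proof
    assume "max_degree V E \<ge> 5"
    \<comment> \<open>The maximum is attained, and since it is at least 5 it is not the default
      \<open>0\<close> but the degree of a vertex.\<close>
    moreover have "max_degree V E \<in> insert 0 (degree E ` V)"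
      unfolding max_degree_def using finV by (intro Max_in) auto
    ultimately obtain v where v: "v \<in> V" "5 \<le> degree E v"
      by auto
    obtain L where L: "L \<subseteq> {u. {v, u} \<in> E}" "card L = 5" "finite L"
      using obtain_subset_with_card_n[OF v(2)[unfolded degree_def]] by blast
    obtain g where g: "bij_betw g {1..5::nat} L"
      using ex_bij_betw_nat_finite_1[OF L(3)] L(2) by auto
    then have inj_g: "inj_on g {1..5}" and im_g: "g ` {1..5} = L"
      by (simp_all add: bij_betw_def)
    define h where "h i = (if i = 0 then v else g i)" for i :: nat
    have gL: "g i \<in> L" if "i \<in> {1..5}" for i
      using im_g that by blast
    have gE: "{v, g i} \<in> E" "g i \<in> V" "g i \<noteq> v" if "i \<in> {1..5}" for i
    proof -
      show "{v, g i} \<in> E"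
        using gL[OF that] L(1) by blast
      then show "g i \<in> V" "g i \<noteq> v"
        using edgesV by metis+
    qed
    show ?thesis
    proof (rule nonplanar_token_embed[OF finV])
      show "inj_on h {..5}"
      proof (rule inj_onI)
        fix i j
        assume ij: "i \<in> {..5}" "j \<in> {..5}" "h i = h j"
        consider "i = 0" "j = 0" | "i \<in> {1..5}" "j = 0" | "i = 0" "j \<in> {1..5}"
          | "i \<in> {1..5}" "j \<in> {1..5}"
          using ij(1,2) by fastforce
        then show "i = j"
        proof cases
          case 4
          then show ?thesis
            using ij(3) inj_onD[OF inj_g, of i j] by (simp add: h_def)
        qed (use ij(3) gE(3)[of i] gE(3)[of j] in \<open>simp_all add: h_def\<close>)
      qed
      show "h ` {..5} \<subseteq> V"
        using gE(2) v(1) by (fastforce simp: h_def)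
      show "{h a, h b} \<in> E" if ab: "{a, b} \<in> star_edges 5" for a b
      proof -
        obtain i where i: "{a, b} = {0, i}" "i \<in> {1..5}"
          using ab unfolding star_edges_def by blast
        have "{h a, h b} = h ` {a, b}"
          by simp
        also have "\<dots> = {v, g i}"
          unfolding i(1) using i(2) by (simp add: h_def insert_commute)
        finally show ?thesis
          using gE(1)[OF i(2)] by simp
      qed
      show "\<not> planar (token_vertices {..5} j) (token_edges {..5} (star_edges 5) j)"
        if "2 \<le> j" "j + 2 \<le> card {..5::nat}" for j
        using nonplanar_star[OF that] .
    qed (use assms in simp_all)
  next
    assume c: "circumference V E \<ge> 5"
    \<comment> \<open>This bound makes the set of cycle lengths finite, so that \<open>Max\<close>
      is attained by an actual cycle.\<close>
    have "length vs \<le> card V" if "is_cycle V E vs" for vs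
    proof -
      have "length vs = card (set vs)" "set vs \<subseteq> V"
        using that distinct_card[of vs] by (simp_all add: is_cycle_def)
      then show ?thesis
        using card_mono[OF finV] by simp
    qed
    then have "{length vs |vs. is_cycle V E vs} \<subseteq> {..card V}"
      by blast
    then have "finite {length vs |vs. is_cycle V E vs}"
      by (rule finite_subset) simp
    then have "circumference V E \<in> insert 0 {length vs |vs. is_cycle V E vs}"
      unfolding circumference_def by (intro Max_in) auto
    then obtain vs where vs: "is_cycle V E vs" "5 \<le> length vs"
      using c by auto
    show ?thesis
    \<comment> \<open>Indexing into the list \<open>vs\<close> serves as the embedding of the cycle
      on \<open>{..<length vs}\<close>.\<close>
    proof (rule nonplanar_token_embed[OF finV])
      show "inj_on ((!) vs) {..<length vs}"
        using vs by (auto simp: is_cycle_def inj_on_def nth_eq_iff_index_eq)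
      show "(!) vs ` {..<length vs} \<subseteq> V"
        using vs by (auto simp: is_cycle_def)
      show "{vs ! a, vs ! b} \<in> E" if ab: "{a, b} \<in> circular_edges (length vs)" for a b
      proof -
        have "vs \<noteq> []"
          using vs by auto
        then have closing: "{vs ! 0, vs ! (length vs - 1)} \<in> E"
          using vs by (simp add: is_cycle_def hd_conv_nth last_conv_nth insert_commute)
        have image: "{vs ! a, vs ! b} = (!) vs ` {a, b}"
          by simp
        from ab consider "{a, b} = {0, length vs - 1}"
          | i where "i \<in> {..<length vs - 1}" "{a, b} = {i, Suc i}"
          unfolding circular_edges_def by (elim insertE imageE)
        then show ?thesis
        proof cases
          case 1
          show ?thesis
            unfolding image 1 using closing by simp
        next
          case 2
          show ?thesis
            unfolding image 2(2) using vs(1) 2(1) by (simp add: is_cycle_def)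
        qed
      qed
      show "\<not> planar (token_vertices {..<length vs} j)
          (token_edges {..<length vs} (circular_edges (length vs)) j)"
        if "2 \<le> j" "j + 2 \<le> card {..<length vs}" for j
        using nonplanar_token_cycle[OF vs(2) that(1)] that(2) by simp
    qed (use vs assms in simp_all)
  qed
qed

end
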